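(* Let $n,a,b,r$ be positive integers with $n\ge a+b$, and let $\mathcal A\subset\binom{[n]}{a}$, $\mathcal B\subset\binom{[n]}{b}$ be cross-intersecting. Suppose one of the following holds: (i) $a<b$ and $|\mathcal A|\ge r$; (ii) $a=b$ and $|\mathcal A|,|\mathcal B|\ge r$; (iii) $a>b$, $|\mathcal A|\ge r$ and $|\mathcal B|\ge\binom{n}{b}-\binom{n-a+b}{b}+r$. Then for $1\le r\le b-1$, \[ |\mathcal A|+|\mathcal B|\le\binom{n}{b}-\binom{n-a+1}{b}+\binom{n-a-r+1}{b-r}+r, \] and for $b\le r\le n-a+1$, \[ |\mathcal A|+|\mathcal B|\le\binom{n}{b}-\binom{n-a+1}{b}+n-a+1. \]
   Context: $\mathcal A,\mathcal B$ are cross-intersecting if $A\cap B\ne\emptyset$ for all $A\in\mathcal A$, $B\in\mathcal B$. Binomial coefficients $\binom{m}{j}$ are $0$ when $j<0$ or $j>m$. *)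

theory Defs
  imports "HOL-Library.Ramsey"
begin

definition cross_intersecting :: "'a set set \<Rightarrow> 'a set set \<Rightarrow> bool" where
  "cross_intersecting \<A> \<B> \<longleftrightarrow> (\<forall>A\<in>\<A>. \<forall>B\<in>\<B>. A \<inter> B \<noteq> {})"

end

theory Submission
  imports Complex_Main Defs
begin

text \<open>
  Fix a point \<open>x\<close>. Replacing \<open>V\<close> by \<open>U\<close> in members of both families, where \<open>x \<in> U - V\<close> and
  \<open>|U| = |V|\<close>, keeps them cross-intersecting if all such replacements with smaller \<open>|U|\<close> already
  leave the families unchanged. Once no replacement has any effect, a family with a member avoiding
  \<open>x\<close> has every set through \<open>x\<close>, so all members of the other family contain \<open>x\<close>.

  The theorem follows by induction on \<open>a\<close> with \<open>d = n - a\<close> fixed. If all of \<open>\<A>\<close> contains \<open>x\<close>,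
  remove \<open>x\<close> from \<open>\<A>\<close> and keep the members of \<open>\<B>\<close> avoiding \<open>x\<close>; both sides of the bound drop by
  \<open>(n - 1) choose (b - 1)\<close>, and the size hypotheses pass on. If all of \<open>\<B>\<close> contains \<open>x\<close>, then
  \<open>a > b\<close> contradicts the lower bound on \<open>|\<B>|\<close>, the case \<open>a = b\<close> is symmetric, and for \<open>a < b\<close>
  the members of \<open>\<A>\<close> avoiding \<open>x\<close> and the sets \<open>B - {x}\<close> number at most
  \<open>(n - 1) choose (b - 1)\<close> by double counting disjoint pairs.
\<close>

section \<open>Compression towards a fixed point\<close>

definition stable :: "'a set \<Rightarrow> 'a set \<Rightarrow> 'a set set \<Rightarrow> bool" where
  "stable U V F \<longleftrightarrow> (\<forall>X\<in>F. V \<subseteq> X \<and> X \<inter> U = {} \<longrightarrow> X - V \<union> U \<in> F)"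

definition compr :: "'a set \<Rightarrow> 'a set \<Rightarrow> 'a set set \<Rightarrow> 'a set \<Rightarrow> 'a set" where
  "compr U V F X = (if V \<subseteq> X \<and> X \<inter> U = {} \<and> X - V \<union> U \<notin> F then X - V \<union> U else X)"

text \<open>A moved set lands outside \<open>F\<close>, so it cannot equal an unmoved member, and
  two moved sets are recovered from their images by undoing the exchange.\<close>

lemma inj_on_compr:
  assumes "U \<inter> V = {}"
  shows "inj_on (compr U V F) F"
proof (rule inj_onI)
  fix X Y assume XY: "X \<in> F" "Y \<in> F" "compr U V F X = compr U V F Y"
  have *: "X - V \<union> U - U \<union> V = X" if "V \<subseteq> X" "X \<inter> U = {}" for X
    using that assms by blast
  define mv where "mv Z \<longleftrightarrow> V \<subseteq> Z \<and> Z \<inter> U = {} \<and> Z - V \<union> U \<notin> F" for Z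
  have eq: "compr U V F Z = (if mv Z then Z - V \<union> U else Z)" for Z
    by (simp add: compr_def mv_def)
  have "mv X \<longleftrightarrow> mv Y" using XY unfolding eq mv_def by metis
  then show "X = Y" using XY(3) *[of X] *[of Y] unfolding eq mv_def by metis
qed

lemma compr_nsets:
  assumes "F \<subseteq> nsets S k" "U \<subseteq> S" "finite U" "card U = card V"
  shows "compr U V F ` F \<subseteq> nsets S k"
proof
  fix Y assume "Y \<in> compr U V F ` F"
  then obtain X where X: "X \<in> F" and Y: "Y = compr U V F X" by blast
  have Xn: "X \<in> nsets S k" using X assms by blast
  show "Y \<in> nsets S k"
  proof (cases "V \<subseteq> X \<and> X \<inter> U = {}")
    case True
    then have "finite X" "finite V" using Xn by (auto simp: nsets_def intro: finite_subset)
    then have "card (X - V \<union> U) = card X - card V + card U"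
      using True assms by (subst card_Un_disjoint) (auto simp: card_Diff_subset)
    moreover have "card V \<le> card X" using True \<open>finite X\<close> by (simp add: card_mono)
    ultimately have "X - V \<union> U \<in> nsets S k"
      using Xn assms by (auto simp: nsets_def)
    then show ?thesis using Xn Y by (auto simp: compr_def)
  next
    case False
    then show ?thesis using Xn Y by (auto simp: compr_def)
  qed
qed

text \<open>Every moved set gains \<open>x\<close>, so members avoiding \<open>x\<close> are only
  lost. Their number is the measure that makes repeated compression terminate.\<close>

lemma card_compr_avoiding:
  assumes "finite F" "U \<inter> V = {}" "x \<in> U"
  shows "card {X \<in> compr U V F ` F. x \<notin> X} \<le> card {X \<in> F. x \<notin> X}"
    and "\<not> stable U V F \<Longrightarrow> card {X \<in> compr U V F ` F. x \<notin> X} < card {X \<in> F. x \<notin> X}"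
proof -
  have sub: "{X \<in> compr U V F ` F. x \<notin> X} \<subseteq> {X \<in> F. x \<notin> X}"
    using assms by (auto simp: compr_def split: if_splits)
  then show "card {X \<in> compr U V F ` F. x \<notin> X} \<le> card {X \<in> F. x \<notin> X}"
    using assms by (simp add: card_mono)
  assume "\<not> stable U V F"
  then obtain X where X: "X \<in> F" "V \<subseteq> X" "X \<inter> U = {}" "X - V \<union> U \<notin> F"
    by (auto simp: stable_def)
  have "X \<noteq> compr U V F Y" if "Y \<in> F" for Y
    using X that assms by (auto simp: compr_def)
  then have "X \<in> {X \<in> F. x \<notin> X} - {X \<in> compr U V F ` F. x \<notin> X}"
    using X assms by auto
  then have "{X \<in> compr U V F ` F. x \<notin> X} \<subset> {X \<in> F. x \<notin> X}" using sub by blast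
  then show "card {X \<in> compr U V F ` F. x \<notin> X} < card {X \<in> F. x \<notin> X}"
    using assms by (simp add: psubset_card_mono)
qed

lemma cross_intersecting_commute: "cross_intersecting A B \<longleftrightarrow> cross_intersecting B A"
  unfolding cross_intersecting_def by blast

text \<open>If the moved \<open>X\<close> missed the image of \<open>Y\<close>, then
  \<open>Y\<close> would be unmoved and meet \<open>X\<close> only inside \<open>V\<close>. Either
  \<open>Y\<close> was blocked by \<open>Y - V \<union> U\<close> in \<open>B\<close>, which misses
  \<open>X\<close>, or a smaller exchange gives a member of \<open>A\<close> missing
  \<open>Y\<close>.\<close>

lemma compr_moved_meets:
  assumes cross: "cross_intersecting A B"
    and UV: "U \<inter> V = {}" "finite U" "finite V" "card U = card V" "x \<in> U"
    and smaller: "\<And>U' V'. U' \<subset> U \<Longrightarrow> V' \<subset> V \<Longrightarrow> x \<in> U' \<Longrightarrow> card U' = card V' \<Longrightarrow> stable U' V' A"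
    and X: "X \<in> A" "V \<subseteq> X" "X \<inter> U = {}" "X - V \<union> U \<notin> A"
    and Y: "Y \<in> B"
  shows "(X - V \<union> U) \<inter> compr U V B Y \<noteq> {}"
proof
  assume dis: "(X - V \<union> U) \<inter> compr U V B Y = {}"
  then have Ydis: "compr U V B Y \<inter> U = {}" by blast
  then have eq: "compr U V B Y = Y" using UV by (auto simp: compr_def split: if_splits)
  have YU: "Y \<inter> U = {}" and d: "(X - V) \<inter> Y = {}" using Ydis dis eq by auto
  have XY: "X \<inter> Y \<noteq> {}" using cross X Y by (auto simp: cross_intersecting_def)
  show False
  proof (cases "V \<subseteq> Y")
    case True
    then have "Y - V \<union> U \<in> B" using eq YU UV by (auto simp: compr_def split: if_splits)
    then have "X \<inter> (Y - V \<union> U) \<noteq> {}" using cross X by (auto simp: cross_intersecting_def)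
    then show False using d X by blast
  next
    case False
    then obtain v where v: "v \<in> V" "v \<notin> Y" by blast
    obtain w where w: "w \<in> V" "w \<in> Y" using XY d by blast
    have "card {v, w} \<le> card V" using v w UV by (intro card_mono) auto
    then have "2 \<le> card U" using v w UV by (cases "v = w") auto
    then have "\<not> U \<subseteq> {x}" using card_mono[of "{x}" U] by auto
    then obtain u where u: "u \<in> U" "u \<noteq> x" by blast
    have "stable (U - {u}) (V - {v}) A"
      using u v UV by (intro smaller) auto
    then have "X - (V - {v}) \<union> (U - {u}) \<in> A"
      using X unfolding stable_def by (meson Diff_subset Int_Diff disjoint_iff subset_iff)
    then have "(X - (V - {v}) \<union> (U - {u})) \<inter> Y \<noteq> {}"
      using cross Y by (auto simp: cross_intersecting_def)
    then show False using d v YU by blast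
  qed
qed

lemma cross_intersecting_compr:
  assumes cross: "cross_intersecting A B"
    and UV: "U \<inter> V = {}" "finite U" "finite V" "card U = card V" "x \<in> U"
    and smaller: "\<And>U' V'. U' \<subset> U \<Longrightarrow> V' \<subset> V \<Longrightarrow> x \<in> U' \<Longrightarrow> card U' = card V'
      \<Longrightarrow> stable U' V' A \<and> stable U' V' B"
  shows "cross_intersecting (compr U V A ` A) (compr U V B ` B)"
proof -
  have "compr U V A X \<inter> compr U V B Y \<noteq> {}" if XY: "X \<in> A" "Y \<in> B" for X Y
  proof -
    consider "V \<subseteq> X" "X \<inter> U = {}" "X - V \<union> U \<notin> A" | "V \<subseteq> Y" "Y \<inter> U = {}" "Y - V \<union> U \<notin> B"
      | "compr U V A X = X" "compr U V B Y = Y"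
      by (metis compr_def)
    then show ?thesis
    proof cases
      case 1
      then have "(X - V \<union> U) \<inter> compr U V B Y \<noteq> {}"
        using compr_moved_meets[OF cross UV] smaller XY by blast
      then show ?thesis using 1 by (simp add: compr_def)
    next
      case 2
      then have "(Y - V \<union> U) \<inter> compr U V A X \<noteq> {}"
        using compr_moved_meets[OF _ UV, of B A] cross smaller XY
        by (simp add: cross_intersecting_commute)
      then show ?thesis using 2 by (auto simp: compr_def[of U V B])
    next
      case 3
      then show ?thesis using cross XY by (auto simp: cross_intersecting_def)
    qed
  qed
  then show ?thesis by (auto simp: cross_intersecting_def)
qed

lemma exists_stable_families:
  fixes S :: "'a set"
  assumes "finite S" "x \<in> S" "A \<subseteq> nsets S a" "B \<subseteq> nsets S b" "cross_intersecting A B"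
  shows "\<exists>A' B'. A' \<subseteq> nsets S a \<and> B' \<subseteq> nsets S b \<and> cross_intersecting A' B' \<and>
    card A' = card A \<and> card B' = card B \<and>
    (\<forall>U V. x \<in> U \<and> x \<notin> V \<and> U \<subseteq> S \<and> V \<subseteq> S \<and> U \<inter> V = {} \<and> card U = card V
      \<longrightarrow> stable U V A' \<and> stable U V B')"
  using assms(3-5)
proof (induction "card {X \<in> A. x \<notin> X} + card {X \<in> B. x \<notin> X}" arbitrary: A B rule: less_induct)
  case less
  define ok where "ok U V \<longleftrightarrow> x \<in> U \<and> x \<notin> V \<and> U \<subseteq> S \<and> V \<subseteq> S \<and> U \<inter> V = {} \<and> card U = card V"
    for U V
  show ?case
  proof (cases "\<forall>U V. ok U V \<longrightarrow> stable U V A \<and> stable U V B")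
    case True
    then show ?thesis using less.prems unfolding ok_def by blast
  next
    case False
    define bad where "bad k \<longleftrightarrow> (\<exists>U V. ok U V \<and> card U = k \<and> \<not> (stable U V A \<and> stable U V B))" for k
    have "\<exists>k. bad k" using False unfolding bad_def by blast
    \<comment> \<open>Minimality of \<open>k\<close> supplies the stability under smaller exchanges
      on which cross-intersection of the images depends.\<close>
    then obtain k where k: "bad k" "\<And>j. j < k \<Longrightarrow> \<not> bad j" by (metis LeastI_ex not_less_Least)
    then obtain U V where UV: "ok U V" "card U = k" "\<not> (stable U V A \<and> stable U V B)"
      unfolding bad_def by blast
    have fin: "finite U" "finite V" using UV assms(1) by (auto simp: ok_def intro: finite_subset)
    have smaller: "stable U' V' A \<and> stable U' V' B"
      if "U' \<subset> U" "V' \<subset> V" "x \<in> U'" "card U' = card V'" for U' V'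
    proof -
      have "ok U' V'" using that UV(1) unfolding ok_def by blast
      moreover have "card U' < k" using that fin UV(2) psubset_card_mono by blast
      ultimately show ?thesis using k(2) unfolding bad_def by blast
    qed
    define A1 where "A1 = compr U V A ` A"
    define B1 where "B1 = compr U V B ` B"
    have finAB: "finite A" "finite B"
      using less.prems assms(1) by (auto intro: finite_subset simp: finite_imp_finite_nsets)
    have ok: "U \<inter> V = {}" "card U = card V" "x \<in> U" "U \<subseteq> S" using UV(1) by (auto simp: ok_def)
    have cross: "cross_intersecting A1 B1" unfolding A1_def B1_def
      using cross_intersecting_compr[OF less.prems(3) ok(1) fin ok(2,3)] smaller by blast
    have sub: "A1 \<subseteq> nsets S a" "B1 \<subseteq> nsets S b"
      unfolding A1_def B1_def using compr_nsets less.prems ok fin by blast+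
    have card: "card A1 = card A" "card B1 = card B"
      unfolding A1_def B1_def using inj_on_compr[OF ok(1)] by (auto intro: card_image)
    have "card {X \<in> A1. x \<notin> X} + card {X \<in> B1. x \<notin> X} < card {X \<in> A. x \<notin> X} + card {X \<in> B. x \<notin> X}"
      unfolding A1_def B1_def
      using card_compr_avoiding[OF finAB(1) ok(1,3)] card_compr_avoiding[OF finAB(2) ok(1,3)] UV(3)
      by (meson add_le_less_mono add_less_le_mono)
    from less.hyps[OF this sub cross] show ?thesis unfolding card .
  qed
qed

lemma exists_star_family:
  assumes "finite S" "x \<in> S" "A \<subseteq> nsets S a" "B \<subseteq> nsets S b" "cross_intersecting A B"
    and ab: "0 < a" "a + b \<le> card S"
  obtains A' B' where "A' \<subseteq> nsets S a" "B' \<subseteq> nsets S b" "cross_intersecting A' B'"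
    "card A' = card A" "card B' = card B" "(\<forall>X\<in>A'. x \<in> X) \<or> (\<forall>Y\<in>B'. x \<in> Y)"
proof -
  obtain A' B' where *: "A' \<subseteq> nsets S a" "B' \<subseteq> nsets S b" "cross_intersecting A' B'"
    "card A' = card A" "card B' = card B"
    and st: "\<And>U V. x \<in> U \<Longrightarrow> x \<notin> V \<Longrightarrow> U \<subseteq> S \<Longrightarrow> V \<subseteq> S \<Longrightarrow> U \<inter> V = {} \<Longrightarrow> card U = card V
      \<Longrightarrow> stable U V A' \<and> stable U V B'"
    using exists_stable_families[OF assms(1-5)] by auto
  have "(\<forall>X\<in>A'. x \<in> X) \<or> (\<forall>Y\<in>B'. x \<in> Y)"
  proof (rule ccontr)
    assume "\<not> ?thesis"
    then obtain X Y where X: "X \<in> A'" "x \<notin> X" and Y: "Y \<in> B'" "x \<notin> Y" by blast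
    have Xn: "X \<subseteq> S" "finite X" "card X = a" and Yn: "Y \<subseteq> S" "finite Y" "card Y = b"
      using X Y * by (auto simp: nsets_def)
    have "card (S - insert x Y) = card S - Suc b"
      using Yn Y assms(1,2) by (subst card_Diff_subset) auto
    then have "a - 1 \<le> card (S - insert x Y)" using ab by simp
    then obtain Z0 where Z0: "Z0 \<subseteq> S - insert x Y" "card Z0 = a - 1" "finite Z0"
      by (meson obtain_subset_with_card_n)
    \<comment> \<open>An \<open>a\<close>-set through \<open>x\<close> that misses \<open>Y\<close>;
      \<open>a + b \<le> card S\<close> leaves room for it. Exchanging \<open>X - Z\<close> for
      \<open>Z - X\<close> turns \<open>X\<close> into \<open>Z\<close>.\<close>
    define Z where "Z = insert x Z0"
    have Z: "Z \<subseteq> S" "finite Z" "card Z = a" "x \<in> Z" "Z \<inter> Y = {}"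
      using Z0 ab assms(2) Y by (auto simp: Z_def card_insert_if)
    have "card (Z - X) = card (X - Z)"
      using Z Xn by (simp add: card_Diff_subset_Int Int_commute)
    then have "stable (Z - X) (X - Z) A'"
      using st[of "Z - X" "X - Z"] Z Xn X by blast
    then have "X - (X - Z) \<union> (Z - X) \<in> A'" using X unfolding stable_def by blast
    moreover have "X - (X - Z) \<union> (Z - X) = Z" by blast
    ultimately show False using * Y Z by (auto simp: cross_intersecting_def)
  qed
  then show thesis using that * by blast
qed

section \<open>Counting sets of fixed size and comparing binomials\<close>

lemma card_nsets:
  assumes "finite S"
  shows "card (nsets S k) = card S choose k"
proof -
  have "nsets S k = {N. N \<subseteq> S \<and> card N = k}"
    using assms by (auto simp: nsets_def intro: finite_subset)
  then show ?thesis using assms by (simp add: n_subsets)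
qed

lemma card_le_of_common_subset:
  assumes "finite S" "B \<subseteq> nsets S b" "\<And>Y. Y \<in> B \<Longrightarrow> T \<subseteq> Y" "T \<subseteq> S"
  shows "card B \<le> (card S - card T) choose (b - card T)"
proof -
  have T: "finite T" using assms finite_subset by blast
  have "inj_on (\<lambda>Y. Y - T) B"
    using assms(3) by (intro inj_onI) blast
  moreover have "(\<lambda>Y. Y - T) ` B \<subseteq> nsets (S - T) (b - card T)"
    using assms(2,3) T by (auto simp: nsets_def card_Diff_subset subset_iff)
  ultimately have "card B \<le> card (nsets (S - T) (b - card T))"
    using assms(1) by (intro card_inj_on_le finite_imp_finite_nsets) auto
  then show ?thesis
    using assms T by (simp add: card_nsets card_Diff_subset)
qed

lemma binomial_le_of_sum_le:
  assumes "i \<le> j" "i + j \<le> n"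
  shows "n choose i \<le> n choose j"
proof (cases "2 * j \<le> n")
  case False
  then have "n choose i \<le> n choose (n - j)" using assms by (intro binomial_mono) auto
  then show ?thesis using assms binomial_symmetric[of j n] by simp
qed (use assms binomial_mono in auto)

text \<open>Both products count disjoint pairs of an \<open>a\<close>-set and a
  \<open>b\<close>-set; as \<open>n choose a\<close> is at most \<open>n choose b\<close>, the other
  factors compare the opposite way.\<close>

lemma binomial_diff_swap_le:
  assumes "a \<le> b" "a + b \<le> n"
  shows "(n - b) choose a \<le> (n - a) choose b"
proof -
  have "(n choose a) * ((n - b) choose a) \<le> (n choose b) * ((n - b) choose a)"
    using binomial_le_of_sum_le[OF assms] by simp
  also have "\<dots> = (n choose (a + b)) * ((a + b) choose b)"
    using choose_mult[of b "a + b" n] assms by simp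
  also have "(a + b) choose b = (a + b) choose a"
    using binomial_symmetric[of b "a + b"] by simp
  also have "(n choose (a + b)) * ((a + b) choose a) = (n choose a) * ((n - a) choose b)"
    using choose_mult[of a "a + b" n] assms by simp
  finally show ?thesis using assms by simp
qed

lemma cross_intersecting_card_sum_le:
  assumes "finite S" "A \<subseteq> nsets S a" "B \<subseteq> nsets S b" "cross_intersecting A B"
    and ab: "a \<le> b" "a + b \<le> card S"
  shows "card A + card B \<le> card S choose b"
proof -
  define n where "n = card S"
  define N where "N = {Y \<in> nsets S b. \<exists>X\<in>A. X \<inter> Y = {}}"
  have fin: "finite A" "finite B" "finite N"
    using assms(1-3) by (auto simp: N_def finite_imp_finite_nsets intro: finite_subset)
  have dX: "card {Y \<in> N. X \<inter> Y = {}} = (n - a) choose b" if "X \<in> A" for X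
  proof -
    have X: "X \<subseteq> S" "finite X" "card X = a" using that assms(2) by (auto simp: nsets_def)
    have "{Y \<in> N. X \<inter> Y = {}} = nsets (S - X) b" using that by (auto simp: N_def nsets_def)
    then show ?thesis using X assms(1) by (simp add: card_nsets card_Diff_subset n_def)
  qed
  have dY: "card {X \<in> A. X \<inter> Y = {}} \<le> (n - b) choose a" if "Y \<in> N" for Y
  proof -
    have Y: "Y \<subseteq> S" "finite Y" "card Y = b" using that by (auto simp: N_def nsets_def)
    have "{X \<in> A. X \<inter> Y = {}} \<subseteq> nsets (S - Y) a" using assms(2) by (auto simp: nsets_def)
    then have "card {X \<in> A. X \<inter> Y = {}} \<le> card (nsets (S - Y) a)"
      using assms(1) by (intro card_mono finite_imp_finite_nsets) auto
    then show ?thesis using Y assms(1) by (simp add: card_nsets card_Diff_subset n_def)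
  qed
  \<comment> \<open>Disjoint pairs between \<open>A\<close> and \<open>N\<close> are counted from
    both sides. The factor cancelled at the end is positive because
    \<open>a \<le> n - b\<close>.\<close>
  have "card A * ((n - b) choose a) \<le> card A * ((n - a) choose b)"
    using binomial_diff_swap_le ab by (simp add: n_def)
  also have "\<dots> = (\<Sum>X\<in>A. card {Y \<in> N. X \<inter> Y = {}})" using dX by simp
  also have "\<dots> = (\<Sum>Y\<in>N. card {X \<in> A. X \<inter> Y = {}})"
    using fin by (intro sum_multicount_gen) auto
  also have "\<dots> \<le> card N * ((n - b) choose a)" using sum_mono[of N, OF dY] by simp
  finally have "card A \<le> card N" using ab by (simp add: n_def)
  moreover have "card N + card B \<le> card (nsets S b)"
  proof -
    have "N \<inter> B = {}" using assms(4) by (auto simp: N_def cross_intersecting_def)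
    then have "card N + card B = card (N \<union> B)" using fin by (simp add: card_Un_disjoint)
    also have "\<dots> \<le> card (nsets S b)"
      using assms(1,3) by (intro card_mono finite_imp_finite_nsets) (auto simp: N_def)
    finally show ?thesis .
  qed
  ultimately show ?thesis using assms(1) by (simp add: card_nsets)
qed

text \<open>Equality holds at \<open>k = 1\<close>. By Pascal's rule, passing to
  \<open>Suc k\<close> adds \<open>(d + k) choose Suc k\<close> on the left and the at least as
  large \<open>(d + k) choose (b - 1)\<close> on the right.\<close>

lemma binomial_exchange_le:
  assumes "1 \<le> k" "Suc k \<le> b" "b \<le> d"
  shows "((d + k) choose k) + (Suc d choose b) \<le> ((d + k) choose b) + Suc d"
  using assms
proof (induction k rule: dec_induct)
  case base
  then show ?case by simp
next
  case (step k)
  obtain c where c: "b = Suc c" using step by (cases b) auto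
  have "(d + k) choose Suc k \<le> (d + k) choose c"
    using step.prems step.hyps c by (intro binomial_le_of_sum_le) auto
  then show ?case using step c by simp
qed

section \<open>Induction on the set size with fixed codimension\<close>

lemma split_at_common_element:
  fixes S :: "'a set"
  assumes "finite S" "x \<in> S" "card S = Suc N" "A \<subseteq> nsets S a" "B \<subseteq> nsets S b"
    "cross_intersecting A B" "\<And>X. X \<in> A \<Longrightarrow> x \<in> X" "0 < a" "0 < b"
  obtains A1 B0 where "A1 \<subseteq> nsets (S - {x}) (a - 1)" "B0 \<subseteq> nsets (S - {x}) b"
    "cross_intersecting A1 B0" "card A1 = card A" "card B \<le> card B0 + (N choose (b - 1))"
proof
  let ?A1 = "(\<lambda>X. X - {x}) ` A" and ?B0 = "{Y \<in> B. x \<notin> Y}"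
  show "?A1 \<subseteq> nsets (S - {x}) (a - 1)"
    using assms by (force simp: nsets_def)
  show "?B0 \<subseteq> nsets (S - {x}) b" using assms by (auto simp: nsets_def)
  show "cross_intersecting ?A1 ?B0"
    using assms(6) by (fastforce simp: cross_intersecting_def)
  show "card ?A1 = card A"
    using assms(7) by (intro card_image inj_onI) (metis insert_Diff)
  have "finite B" using assms by (meson finite_imp_finite_nsets finite_subset)
  have "card {Y \<in> B. x \<in> Y} \<le> (card S - card {x}) choose (b - card {x})"
    using assms by (intro card_le_of_common_subset) auto
  moreover have "card B = card ?B0 + card {Y \<in> B. x \<in> Y}"
    using \<open>finite B\<close> by (subst card_Un_disjoint[symmetric]) (auto intro: arg_cong[where f = card])
  ultimately show "card B \<le> card ?B0 + (N choose (b - 1))" using assms(3) by simp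
qed

text \<open>
  \<open>K\<close> stands for the summand of the bound that depends on \<open>r\<close>; the two assumptions on it are what
  the case \<open>a = 1\<close> requires. It involves only \<open>d\<close>, \<open>b\<close> and \<open>r\<close>, so the induction leaves it alone.
\<close>

lemma cross_intersecting_bound:
  fixes S :: "'a set"
  assumes "0 < a" "0 < b" "b \<le> d" "0 < r" "Suc d \<le> K"
    and K: "\<And>m. r \<le> m \<Longrightarrow> m \<le> b \<Longrightarrow> ((Suc d - m) choose (b - m)) + m \<le> K"
    and "finite S" "card S = d + a" "A \<subseteq> nsets S a" "B \<subseteq> nsets S b" "cross_intersecting A B"
    and "r \<le> card A" "a = b \<Longrightarrow> r \<le> card B"
      "b < a \<Longrightarrow> ((d + a) choose b) + r \<le> card B + ((d + b) choose b)"
  shows "card A + card B + (Suc d choose b) \<le> ((d + a) choose b) + K"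
  using assms(1,7-)
proof (induction a arbitrary: S A B rule: nat_induct_non_zero)
  case 1
  \<comment> \<open>Members of \<open>A\<close> are singletons, so each member of \<open>B\<close>
    contains all of \<open>T\<close>. If \<open>card T\<close> exceeds \<open>b\<close>, then
    \<open>B\<close> is empty; otherwise \<open>K\<close> is used at
    \<open>m = card T\<close>.\<close>
  define T where "T = \<Union>A"
  have sing: "\<exists>z\<in>S. X = {z}" if "X \<in> A" for X
    using that 1 by (auto simp: nsets_def card_1_singleton_iff)
  have TS: "T \<subseteq> S" "finite T" using sing 1(1) by (auto simp: T_def dest!: sing intro: finite_subset)
  have "A = (\<lambda>z. {z}) ` T" using sing by (force simp: T_def)
  then have cA: "card A = card T" by (simp add: card_image)
  have TY: "T \<subseteq> Y" if "Y \<in> B" for Y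
    using that sing 1(5) by (fastforce simp: T_def cross_intersecting_def)
  have "card A + card B \<le> K"
  proof (cases "card T \<le> b")
    case True
    have "card B \<le> (card S - card T) choose (b - card T)"
      using 1 TY TS by (intro card_le_of_common_subset) auto
    then show ?thesis using K[of "card T"] True cA 1 by simp
  next
    case False
    have "B = {}"
    proof (rule ccontr)
      assume "B \<noteq> {}"
      then obtain Y where Y: "Y \<in> B" by blast
      then have "finite Y" "card Y = b" using 1 by (auto simp: nsets_def)
      then show False using TY[OF Y] False card_mono by blast
    qed
    moreover have "card T \<le> card S" using TS 1(1) by (simp add: card_mono)
    ultimately show ?thesis using cA 1(2) assms(5) by simp
  qed
  then show ?case by simp
next
  case (Suc a)
  obtain c where c: "b = Suc c" using assms(2) by (cases b) auto
  let ?N = "d + a"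
  obtain x where x: "x \<in> S" using Suc.prems(2) by (cases "S = {}") auto
  have Sx: "finite (S - {x})" "card (S - {x}) = ?N" using Suc.prems x by auto
  \<comment> \<open>Kept general in \<open>A'\<close> and \<open>B'\<close> so that it also serves
    with the families interchanged when the sizes agree.\<close>
  have main: ?case if h: "A' \<subseteq> nsets S (Suc a)" "B' \<subseteq> nsets S b" "cross_intersecting A' B'"
      "\<And>X. X \<in> A' \<Longrightarrow> x \<in> X" "r \<le> card A'" "card A' + card B' = card A + card B"
      "b < Suc a \<Longrightarrow> ((d + Suc a) choose b) + r \<le> card B' + ((d + b) choose b)" for A' B'
  proof -
    obtain A1 B0 where *: "A1 \<subseteq> nsets (S - {x}) a" "B0 \<subseteq> nsets (S - {x}) b"
      "cross_intersecting A1 B0" "card A1 = card A'" "card B' \<le> card B0 + (?N choose (b - 1))"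
      using split_at_common_element[of S x ?N A' "Suc a" B' b] h Suc.prems x assms(2) by auto
    have "card A1 + card B0 + (Suc d choose b) \<le> ((d + a) choose b) + K"
    proof (rule Suc.IH[OF Sx *(1,2,3)])
      show "r \<le> card A1" using * h by simp
      \<comment> \<open>Here the lower bound on \<open>card B'\<close> for size \<open>Suc a\<close>
        collapses: after Pascal's rule both remaining binomials are
        \<open>(d + b) choose b\<close>.\<close>
      show "r \<le> card B0" if "a = b" using h(7) *(5) that c by simp
      show "((d + a) choose b) + r \<le> card B0 + ((d + b) choose b)" if "b < a"
        using h(7) *(5) that c by simp
    qed
    then show ?thesis using *(4,5) h(6) c by simp
  qed
  obtain A' B' where *: "A' \<subseteq> nsets S (Suc a)" "B' \<subseteq> nsets S b" "cross_intersecting A' B'"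
    "card A' = card A" "card B' = card B" "(\<forall>X\<in>A'. x \<in> X) \<or> (\<forall>Y\<in>B'. x \<in> Y)"
    using exists_star_family[OF Suc.prems(1) x Suc.prems(3,4,5)] Suc.prems(2) assms(3) by auto
  show ?case
  proof (cases "\<forall>X\<in>A'. x \<in> X")
    case True
    then show ?thesis using * Suc.prems by (intro main[of A' B']) auto
  next
    case False
    then have Bx: "\<And>Y. Y \<in> B' \<Longrightarrow> x \<in> Y" using * by blast
    consider "b < Suc a" | "b = Suc a" | "Suc a < b" by linarith
    then show ?thesis
    proof cases
      case 1
      \<comment> \<open>This is contradictory: the lower bound on \<open>card B\<close> forces at
        least \<open>(?N choose c) + r\<close> members, and \<open>r\<close> is positive.\<close>
      have "card B' \<le> (card S - card {x}) choose (b - card {x})"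
        using * Suc.prems(1) Bx x by (intro card_le_of_common_subset) auto
      then have "card B' \<le> ?N choose c" using Suc.prems(2) c by simp
      moreover have "(d + b) choose b \<le> ?N choose b" using 1 by (intro binomial_right_mono) auto
      ultimately show ?thesis using Suc.prems(8)[OF 1] *(5) c assms(4) by simp
    next
      case 2
      then show ?thesis using * Suc.prems Bx
        by (intro main[of B' A']) (auto simp: cross_intersecting_commute)
    next
      case 3
      \<comment> \<open>The roles are swapped: \<open>x\<close> is removed from \<open>B'\<close>.
        Now \<open>Suc a \<le> b - 1\<close>, and the two sizes sum to
        \<open>a + b \<le> ?N\<close>, so the double counting bound applies.\<close>
      obtain B1 A0 where **: "B1 \<subseteq> nsets (S - {x}) (b - 1)" "A0 \<subseteq> nsets (S - {x}) (Suc a)"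
        "cross_intersecting B1 A0" "card B1 = card B'" "card A' \<le> card A0 + (?N choose a)"
        using split_at_common_element[of S x ?N B' b A' "Suc a"] * Suc.prems x assms(2) Bx
        by (auto simp: cross_intersecting_commute)
      have "card A0 + card B1 \<le> card (S - {x}) choose (b - 1)"
        using ** Sx 3 assms(3)
        by (intro cross_intersecting_card_sum_le[of _ _ "Suc a"]) (auto simp: cross_intersecting_commute)
      then have "card A + card B \<le> (?N choose c) + (?N choose a)" using ** * Sx c by simp
      moreover have "(?N choose a) + (Suc d choose b) \<le> (?N choose b) + Suc d"
        using 3 Suc.hyps assms(3) by (intro binomial_exchange_le) auto
      ultimately show ?thesis using c assms(5) by simp
    qed
  qed
qed

section \<open>Choice of \<open>K\<close> in the two ranges of \<open>r\<close>\<close>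

text \<open>By Pascal's rule, raising \<open>m\<close> by one loses
  \<open>(d - m) choose (b - m)\<close>, which is at least the 1 gained. Hence \<open>m = r\<close>
  is the worst case for \<open>K\<close>.\<close>

lemma star_sum_antimono:
  assumes "r \<le> m" "m \<le> b" "b \<le> d"
  shows "((Suc d - m) choose (b - m)) + m \<le> ((Suc d - r) choose (b - r)) + (r::nat)"
  using assms
proof (induction m rule: dec_induct)
  case (step m)
  have e: "Suc d - m = Suc (d - m)" "b - m = Suc (b - Suc m)" using step by auto
  have "0 < (d - m) choose Suc (b - Suc m)" using step by auto
  then have "((Suc d - Suc m) choose (b - Suc m)) + Suc m \<le> ((Suc d - m) choose (b - m)) + m"
    unfolding e by (simp add: Suc_le_eq)
  then show ?case using step by simp
qed simp

theorem theorem5p3: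
  fixes n a b r :: nat and \<A> \<B> :: "nat set set"
  assumes "0 < n" and "0 < a" and "0 < b" and "0 < r"
    and "a + b \<le> n"
    and "\<A> \<subseteq> nsets {1..n} a" and "\<B> \<subseteq> nsets {1..n} b"
    and "cross_intersecting \<A> \<B>"
    and "(a < b \<and> r \<le> card \<A>) \<or>
         (a = b \<and> r \<le> card \<A> \<and> r \<le> card \<B>) \<or>
         (b < a \<and> r \<le> card \<A> \<and>
          int (n choose b) - int ((n - a + b) choose b) + int r \<le> int (card \<B>))"
  shows "(1 \<le> r \<and> r \<le> b - 1 \<longrightarrow>
           int (card \<A>) + int (card \<B>) \<le>
             int (n choose b) - int ((n - a + 1) choose b)
               + int ((n - a - r + 1) choose (b - r)) + int r) \<and>
         (b \<le> r \<and> r \<le> n - a + 1 \<longrightarrow>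
           int (card \<A>) + int (card \<B>) \<le>
             int (n choose b) - int ((n - a + 1) choose b) + int (n - a + 1))"
proof -
  define d where "d = n - a"
  have n: "n = d + a" and bd: "b \<le> d" using assms(5) by (auto simp: d_def)
  have bound: "card \<A> + card \<B> + (Suc d choose b) \<le> (n choose b) + K"
    if "Suc d \<le> K" "\<And>m. r \<le> m \<Longrightarrow> m \<le> b \<Longrightarrow> ((Suc d - m) choose (b - m)) + m \<le> K" for K
    unfolding n
    by (rule cross_intersecting_bound[OF assms(2,3) bd assms(4) that, of "{1..n}"])
       (use assms(6-9) n in auto)
  show ?thesis
  proof (intro conjI impI; elim conjE)
    assume r: "1 \<le> r" "r \<le> b - 1"
    let ?K = "((Suc d - r) choose (b - r)) + r"
    \<comment> \<open>At \<open>m = b - 1\<close> the sum is \<open>(d - b + 2) + (b - 1)\<close>,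
      which is exactly \<open>Suc d\<close>.\<close>
    have "Suc d - (b - 1) = Suc (Suc d - b)" "b - (b - 1) = 1" using r bd by auto
    then have "Suc d \<le> ?K" using star_sum_antimono[of r "b - 1" b d] r bd by simp
    then have "card \<A> + card \<B> + (Suc d choose b) \<le> (n choose b) + ?K"
      using star_sum_antimono[OF _ _ bd] by (intro bound) auto
    moreover have "Suc d - r = d - r + 1" using r bd by simp
    ultimately show "int (card \<A>) + int (card \<B>) \<le> int (n choose b) - int ((n - a + 1) choose b)
        + int ((n - a - r + 1) choose (b - r)) + int r"
      by (simp flip: d_def)
  next
    assume r: "b \<le> r" "r \<le> n - a + 1"
    \<comment> \<open>With \<open>b \<le> r\<close> only \<open>m = b\<close> can occur, where the
      requirement on \<open>K\<close> reads \<open>1 + b \<le> Suc d\<close>.\<close>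
    have "card \<A> + card \<B> + (Suc d choose b) \<le> (n choose b) + Suc d"
      using r bd by (intro bound) auto
    then show "int (card \<A>) + int (card \<B>)
        \<le> int (n choose b) - int ((n - a + 1) choose b) + int (n - a + 1)"
      by (simp flip: d_def)
  qed
qed

end
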